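(* Let $c$ be a symmetric couple. Let $$c=\bigoplus_{\alpha=0}^{p}c_\alpha=\bigoplus_{\beta=0}^{q}c'_\beta$$ be two decompositions of $c$ as direct sums of symmetric couples such that $c_0$ and $c'_0$ are flat and, for all $\alpha,\beta\geq 1$, $c_\alpha$ and $c'_\beta$ are indecomposable and non-flat. Then: (i) $p=q$; (ii) there exist an automorphism $\varphi$ of $c$ and a permutation $\eta$ of $\{1,\dots,p\}$ such that $\varphi c_0=c'_0$ and $\varphi c_\alpha=c'_{\eta(\alpha)}$ for all $\alpha\in\{1,\dots,p\}$.
   Context: A symmetric couple is a couple $c=(\mathcal{G},\sigma)$ where $\mathcal{G}$ is a finite-dimensional real Lie algebra and $\sigma$ is an involutive automorphism of $\mathcal{G}$ such that, if $\mathcal{G}=\mathcal{K}\oplus\mathcal{P}$ is the associated decomposition ($\sigma=\mathrm{id}_{\mathcal{K}}\oplus(-\mathrm{id}_{\mathcal{P}})$), then $\mathcal{K}$ acts faithfully on $\mathcal{P}$ and $[\mathcal{P},\mathcal{P}]=\mathcal{K}$. It is flat if $\mathcal{K}=\{0\}$ (the zero couple is flat). Direct sums of symmetric couples are defined in the obvious way (decomposition of $\mathcal{G}$ as a direct sum of $\sigma$-stable ideals, each with the restricted involution). A symmetric couple is decomposable if it is a direct sum of two non-trivial symmetric couples, and indecomposable otherwise. An automorphism of $c=(\mathcal{G},\sigma)$ is a Lie algebra automorphism of $\mathcal{G}$ commuting with $\sigma$. *)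

theory Defs
  imports Complex_Main "HOL-Library.FuncSet" "HOL-Combinatorics.Permutations"
begin

text \<open>
  A Lie algebra is given by a carrier \<open>G\<close>, a finite-dimensional subspace of an ambient real vector
  space, and a bracket constrained only on \<open>G\<close>; likewise for the involution \<open>\<sigma>\<close> and for
  automorphisms. A subalgebra then shares \<open>br\<close> and \<open>\<sigma>\<close> with \<open>G\<close>: they are automatically
  understood as restricted to its carrier.
\<close>

locale lie_algebra =
  fixes br :: "'a::real_vector \<Rightarrow> 'a \<Rightarrow> 'a" and G :: "'a set"
  assumes subspace: "subspace G"
    and finite_dimensional: "\<exists>B. finite B \<and> span B = G"
    and closed: "\<lbrakk>x \<in> G; y \<in> G\<rbrakk> \<Longrightarrow> br x y \<in> G"
    and add_left: "\<lbrakk>x \<in> G; y \<in> G; z \<in> G\<rbrakk> \<Longrightarrow> br (x + y) z = br x z + br y z"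
    and add_right: "\<lbrakk>x \<in> G; y \<in> G; z \<in> G\<rbrakk> \<Longrightarrow> br x (y + z) = br x y + br x z"
    and scale_left: "\<lbrakk>x \<in> G; y \<in> G\<rbrakk> \<Longrightarrow> br (r *\<^sub>R x) y = r *\<^sub>R br x y"
    and scale_right: "\<lbrakk>x \<in> G; y \<in> G\<rbrakk> \<Longrightarrow> br x (r *\<^sub>R y) = r *\<^sub>R br x y"
    and alternating: "x \<in> G \<Longrightarrow> br x x = 0"
    and jacobi: "\<lbrakk>x \<in> G; y \<in> G; z \<in> G\<rbrakk> \<Longrightarrow>
      br x (br y z) + br y (br z x) + br z (br x y) = 0"

definition lie_ideal :: "('a::real_vector \<Rightarrow> 'a \<Rightarrow> 'a) \<Rightarrow> 'a set \<Rightarrow> 'a set \<Rightarrow> bool" where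
  "lie_ideal br G I \<longleftrightarrow> subspace I \<and> I \<subseteq> G \<and> (\<forall>x\<in>G. \<forall>y\<in>I. br x y \<in> I)"

definition lie_automorphism :: "('a::real_vector \<Rightarrow> 'a \<Rightarrow> 'a) \<Rightarrow> 'a set \<Rightarrow> ('a \<Rightarrow> 'a) \<Rightarrow> bool" where
  "lie_automorphism br G f \<longleftrightarrow>
     bij_betw f G G \<and>
     (\<forall>x\<in>G. \<forall>y\<in>G. f (x + y) = f x + f y) \<and>
     (\<forall>r. \<forall>x\<in>G. f (r *\<^sub>R x) = r *\<^sub>R f x) \<and>
     (\<forall>x\<in>G. \<forall>y\<in>G. f (br x y) = br (f x) (f y))"

definition fixed_part :: "('a::real_vector \<Rightarrow> 'a) \<Rightarrow> 'a set \<Rightarrow> 'a set" where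
  "fixed_part \<sigma> G = {x \<in> G. \<sigma> x = x}"

definition antifixed_part :: "('a::real_vector \<Rightarrow> 'a) \<Rightarrow> 'a set \<Rightarrow> 'a set" where
  "antifixed_part \<sigma> G = {x \<in> G. \<sigma> x = - x}"

text \<open>
  As usual, \<open>[P, P]\<close> denotes the linear span of all brackets of elements of \<open>P\<close>.
  The identity is admitted as an involution; only the zero couple arises from it.
\<close>

locale symmetric_couple = lie_algebra br G
  for br :: "'a::real_vector \<Rightarrow> 'a \<Rightarrow> 'a" and \<sigma> :: "'a \<Rightarrow> 'a" and G :: "'a set" +
  assumes automorphism: "lie_automorphism br G \<sigma>"
    and involutive: "x \<in> G \<Longrightarrow> \<sigma> (\<sigma> x) = x"
    and faithful: "\<lbrakk>x \<in> fixed_part \<sigma> G; \<And>y. y \<in> antifixed_part \<sigma> G \<Longrightarrow> br x y = 0\<rbrakk> \<Longrightarrow> x = 0"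
    and bracket_antifixed:
      "span {br x y |x y. x \<in> antifixed_part \<sigma> G \<and> y \<in> antifixed_part \<sigma> G} = fixed_part \<sigma> G"

definition flat :: "('a::real_vector \<Rightarrow> 'a) \<Rightarrow> 'a set \<Rightarrow> bool" where
  "flat \<sigma> G \<longleftrightarrow> fixed_part \<sigma> G = {0}"

text \<open>The last conjunct says that every element of \<open>G\<close> is uniquely a sum of elements of the \<open>D i\<close>.\<close>

definition couple_direct_sum ::
  "('a::real_vector \<Rightarrow> 'a \<Rightarrow> 'a) \<Rightarrow> ('a \<Rightarrow> 'a) \<Rightarrow> 'a set \<Rightarrow> 'i set \<Rightarrow> ('i \<Rightarrow> 'a set) \<Rightarrow> bool" where
  "couple_direct_sum br \<sigma> G I D \<longleftrightarrow>
     finite I \<and>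
     (\<forall>i\<in>I. lie_ideal br G (D i) \<and> \<sigma> ` D i \<subseteq> D i \<and> symmetric_couple br \<sigma> (D i)) \<and>
     bij_betw (\<lambda>f. \<Sum>i\<in>I. f i) (\<Pi>\<^sub>E i\<in>I. D i) G"

definition decomposable ::
  "('a::real_vector \<Rightarrow> 'a \<Rightarrow> 'a) \<Rightarrow> ('a \<Rightarrow> 'a) \<Rightarrow> 'a set \<Rightarrow> bool" where
  "decomposable br \<sigma> G \<longleftrightarrow>
     (\<exists>D. couple_direct_sum br \<sigma> G {0, 1::nat} D \<and> D 0 \<noteq> {0} \<and> D 1 \<noteq> {0})"

abbreviation indecomposable ::
  "('a::real_vector \<Rightarrow> 'a \<Rightarrow> 'a) \<Rightarrow> ('a \<Rightarrow> 'a) \<Rightarrow> 'a set \<Rightarrow> bool" where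
  "indecomposable br \<sigma> G \<equiv> \<not> decomposable br \<sigma> G"

definition couple_automorphism ::
  "('a::real_vector \<Rightarrow> 'a \<Rightarrow> 'a) \<Rightarrow> ('a \<Rightarrow> 'a) \<Rightarrow> 'a set \<Rightarrow> ('a \<Rightarrow> 'a) \<Rightarrow> bool" where
  "couple_automorphism br \<sigma> G \<phi> \<longleftrightarrow>
     lie_automorphism br G \<phi> \<and> (\<forall>x\<in>G. \<phi> (\<sigma> x) = \<sigma> (\<phi> x))"

end

theory Submission
  imports Defs
begin

text \<open>
  This is a Krull--Schmidt theorem, and the proof follows the classical pattern: Fitting's lemma,
  an exchange of summands one at a time, and reassembly.

  The right class of maps is that of the linear maps commuting with \<open>\<sigma>\<close> and with every \<open>ad x\<close>.
  Kernels and images of such maps are \<open>\<sigma>\<close>-stable ideals, and a \<open>\<sigma>\<close>-stable ideal with a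
  \<open>\<sigma>\<close>-stable complementary ideal is again a symmetric couple (\<open>summand_symmetric_couple\<close>).
  Splitting off the eventual kernel and the eventual image of an endomorphism therefore
  decomposes the finite-dimensional couple, so that every endomorphism of an indecomposable couple
  is bijective or nilpotent (\<open>indecomposable_endo_cases\<close>). As in a local ring, if a sum of
  endomorphisms of a nonzero indecomposable couple is injective, one of its terms is
  (\<open>inj_member_of_inj_sum\<close>).

  Let \<open>M\<close> be an indecomposable non-flat summand of one decomposition, with projection \<open>e\<close>, and let
  \<open>e'\<^sub>k\<close> be the projections of another decomposition. The identity of \<open>M\<close> is the sum of the
  endomorphisms \<open>e \<circ> e'\<^sub>k\<close>, so one of these is injective. Then \<open>e'\<^sub>k\<close> embeds \<open>M\<close> in the \<open>k\<close>-th
  summand, which is therefore not flat, hence indecomposable, and \<open>M\<close> is mapped onto all of it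
  (\<open>matching_summand\<close>). Moreover \<open>M\<close> can be replaced by this summand in the first decomposition
  (\<open>direct_sum_exchange\<close>). When all non-flat summands of the first decomposition have been
  replaced, distinct ones having received distinct partners, the two numbers of non-flat summands
  are seen to be equal by symmetry, and the two flat summands have the same complement; so \<open>e'\<^sub>0\<close>
  maps one onto the other.

  Projections onto ideal summands are homomorphisms of Lie algebras (\<open>component_br\<close>). Hence the
  bijections between matched summands, all induced by projections, add up to an
  automorphism of the couple (\<open>automorphism_of_matching\<close>).
\<close>

section \<open>Chains of subspaces\<close>

lemma subspace_eqI_dim:
  fixes S T :: "'a::real_vector set"
  assumes "subspace S" "subspace T" "S \<subseteq> T" "finite B" "T \<subseteq> span B" "dim T \<le> dim S"
  shows "S = T"
proof -
  obtain b where b: "b \<subseteq> S" "independent b" "S \<subseteq> span b" "card b = dim S"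
    using basis_exists by blast
  obtain b' where b': "b \<subseteq> b'" "b' \<subseteq> T" "independent b'" "T \<subseteq> span b'"
    using maximal_independent_subset_extend[of b T] b assms(3) by blast
  have fin: "finite b'" using independent_span_bound[of B b'] assms b' by auto
  have "card b' = dim T" using b' basis_card_eq_dim by blast
  hence "b = b'" using fin b'(1) b(4) assms(6) by (metis card_seteq)
  thus ?thesis using b b' assms by (metis span_minimal subset_antisym order_trans)
qed

lemma dim_le_card_of_spanning:
  fixes T :: "'a::real_vector set"
  assumes "finite B" "T \<subseteq> span B"
  shows "dim T \<le> card B"
  using assms dim_le_card by blast

lemma increasing_subspaces_stabilize:
  fixes S :: "nat \<Rightarrow> 'a::real_vector set"
  assumes sub: "\<And>n. subspace (S n)" and inc: "\<And>m n. m \<le> n \<Longrightarrow> S m \<subseteq> S n"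
    and B: "finite B" "\<And>n. S n \<subseteq> span B"
  shows "\<exists>n. \<forall>m\<ge>n. S m = S n"
proof -
  have "\<exists>n. \<forall>m. dim (S m) \<le> dim (S n)"
    using ex_has_greatest_nat[of "\<lambda>_. True" 0 "\<lambda>n. dim (S n)" "Suc (card B)"]
      dim_le_card_of_spanning[OF B(1) B(2)] by (auto simp: le_imp_less_Suc)
  thus ?thesis using subspace_eqI_dim[OF sub sub inc B] by metis
qed

lemma decreasing_subspaces_stabilize:
  fixes S :: "nat \<Rightarrow> 'a::real_vector set"
  assumes sub: "\<And>n. subspace (S n)" and dec: "\<And>m n. m \<le> n \<Longrightarrow> S n \<subseteq> S m"
    and B: "finite B" "\<And>n. S n \<subseteq> span B"
  shows "\<exists>n. \<forall>m\<ge>n. S m = S n"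
proof -
  have "\<exists>n. \<forall>m. dim (S n) \<le> dim (S m)"
    using ex_has_least_nat[of "\<lambda>_. True" 0 "\<lambda>n. dim (S n)"] by auto
  thus ?thesis using subspace_eqI_dim[OF sub sub dec B] by metis
qed

section \<open>Equivariant maps\<close>

text \<open>
  For \<open>M = N = G\<close> these are the elements of the centroid of \<open>G\<close> that commute with \<open>\<sigma>\<close>. They need
  not be homomorphisms for the bracket, but unlike homomorphisms they can be added, and their
  images are ideals.
\<close>
definition equivariant ::
  "('a::real_vector \<Rightarrow> 'a \<Rightarrow> 'a) \<Rightarrow> ('a \<Rightarrow> 'a) \<Rightarrow> 'a set \<Rightarrow> 'a set \<Rightarrow> 'a set \<Rightarrow> ('a \<Rightarrow> 'a) \<Rightarrow> bool" where
  "equivariant br \<sigma> G M N f \<longleftrightarrow>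
     f \<in> M \<rightarrow> N \<and>
     (\<forall>x\<in>M. \<forall>y\<in>M. f (x + y) = f x + f y) \<and>
     (\<forall>r. \<forall>x\<in>M. f (r *\<^sub>R x) = r *\<^sub>R f x) \<and>
     (\<forall>x\<in>G. \<forall>y\<in>M. f (br x y) = br x (f y)) \<and>
     (\<forall>x\<in>M. f (\<sigma> x) = \<sigma> (f x))"

lemma equivariantD:
  assumes "equivariant br \<sigma> G M N f"
  shows "\<And>x. x \<in> M \<Longrightarrow> f x \<in> N"
    "\<And>x y. x \<in> M \<Longrightarrow> y \<in> M \<Longrightarrow> f (x + y) = f x + f y"
    "\<And>r x. x \<in> M \<Longrightarrow> f (r *\<^sub>R x) = r *\<^sub>R f x"
    "\<And>x y. x \<in> G \<Longrightarrow> y \<in> M \<Longrightarrow> f (br x y) = br x (f y)"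
    "\<And>x. x \<in> M \<Longrightarrow> f (\<sigma> x) = \<sigma> (f x)"
  using assms unfolding equivariant_def by auto

lemma equivariant_zero:
  assumes "equivariant br \<sigma> G M N f" "subspace M"
  shows "f 0 = 0"
  using equivariantD(3)[OF assms(1), of 0 0] subspace_0[OF assms(2)] by simp

lemma equivariant_diff:
  assumes "equivariant br \<sigma> G M N f" "subspace M" "x \<in> M" "y \<in> M"
  shows "f (x - y) = f x - f y"
  using equivariantD(2)[OF assms(1), of "x - y" y] subspace_diff[OF assms(2)] assms(3,4)
  by simp

lemma equivariant_sum:
  assumes "equivariant br \<sigma> G M N f" "subspace M" "\<And>i. i \<in> I \<Longrightarrow> h i \<in> M"
  shows "f (\<Sum>i\<in>I. h i) = (\<Sum>i\<in>I. f (h i))"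
  using assms(3)
proof (induction I rule: infinite_finite_induct)
  case (insert i I)
  have "(\<Sum>i\<in>I. h i) \<in> M" by (rule subspace_sum[OF assms(2)]) (use insert in auto)
  then show ?case using insert equivariantD(2)[OF assms(1)] by simp
qed (simp_all add: equivariant_zero[OF assms(1,2)])

lemma equivariant_inj_onI:
  assumes "equivariant br \<sigma> G M N f" "subspace M" "\<And>x. x \<in> M \<Longrightarrow> f x = 0 \<Longrightarrow> x = 0"
  shows "inj_on f M"
proof (rule inj_onI)
  fix x y assume xy: "x \<in> M" "y \<in> M" "f x = f y"
  then have "f (x - y) = 0" using equivariant_diff[OF assms(1,2)] by simp
  then have "x - y = 0" using assms(3) subspace_diff[OF assms(2) xy(1,2)] by blast
  then show "x = y" by simp
qed

lemma equivariant_comp: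
  assumes "equivariant br \<sigma> G M N f" "equivariant br \<sigma> G N L g"
  shows "equivariant br \<sigma> G M L (\<lambda>x. g (f x))"
  unfolding equivariant_def[of _ _ _ _ _ "\<lambda>x. g (f x)"]
  using equivariantD[OF assms(1)] equivariantD[OF assms(2)] by simp

lemma equivariant_subset:
  assumes "equivariant br \<sigma> G M N f" "H \<subseteq> G" "M' \<subseteq> M"
  shows "equivariant br \<sigma> H M' N f"
  using assms unfolding equivariant_def by blast

lemma equivariant_funpow:
  assumes "equivariant br \<sigma> G M M f"
  shows "equivariant br \<sigma> G M M (f ^^ n)"
proof (induction n)
  case 0
  show ?case by (simp add: equivariant_def)
next
  case (Suc n)
  show ?case using equivariant_comp[OF Suc assms] by (simp add: comp_def)
qed

section \<open>Stable ideals and direct summands\<close>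

definition stable_ideal ::
  "('a::real_vector \<Rightarrow> 'a \<Rightarrow> 'a) \<Rightarrow> ('a \<Rightarrow> 'a) \<Rightarrow> 'a set \<Rightarrow> 'a set \<Rightarrow> bool" where
  "stable_ideal br \<sigma> G M \<longleftrightarrow> lie_ideal br G M \<and> \<sigma> ` M \<subseteq> M"

lemma stable_idealD:
  assumes "stable_ideal br \<sigma> G M"
  shows "subspace M" "M \<subseteq> G" "\<And>x. x \<in> M \<Longrightarrow> x \<in> G"
    "\<And>x y. x \<in> G \<Longrightarrow> y \<in> M \<Longrightarrow> br x y \<in> M" "\<And>x. x \<in> M \<Longrightarrow> \<sigma> x \<in> M"
  using assms unfolding stable_ideal_def lie_ideal_def by auto

text \<open>
  The functions on the left of \<open>bij_betw\<close> are extensional; the hypotheses are free of this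
  restriction, so that families can be written down without prescribing values outside \<open>I\<close>.
\<close>
lemma bij_betw_sum_PiE:
  fixes D :: "'i \<Rightarrow> 'a::real_vector set"
  assumes sub: "\<And>i. i \<in> I \<Longrightarrow> subspace (D i)"
    and into: "\<And>f. f \<in> Pi I D \<Longrightarrow> (\<Sum>i\<in>I. f i) \<in> G"
    and onto: "\<And>x. x \<in> G \<Longrightarrow> \<exists>f\<in>Pi I D. x = (\<Sum>i\<in>I. f i)"
    and indep: "\<And>f i. f \<in> Pi I D \<Longrightarrow> (\<Sum>i\<in>I. f i) = 0 \<Longrightarrow> i \<in> I \<Longrightarrow> f i = 0"
  shows "bij_betw (\<lambda>f. \<Sum>i\<in>I. f i) (\<Pi>\<^sub>E i\<in>I. D i) G"
proof (rule bij_betw_imageI)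
  show "inj_on (\<lambda>f. \<Sum>i\<in>I. f i) (\<Pi>\<^sub>E i\<in>I. D i)"
  proof (rule inj_onI)
    fix f g assume f: "f \<in> (\<Pi>\<^sub>E i\<in>I. D i)" and g: "g \<in> (\<Pi>\<^sub>E i\<in>I. D i)"
      and eq: "(\<Sum>i\<in>I. f i) = (\<Sum>i\<in>I. g i)"
    have "(\<lambda>i. f i - g i) \<in> Pi I D"
    proof (rule Pi_I)
      fix i assume i: "i \<in> I"
      show "f i - g i \<in> D i" by (rule subspace_diff[OF sub[OF i] PiE_mem[OF f i] PiE_mem[OF g i]])
    qed
    moreover have "(\<Sum>i\<in>I. f i - g i) = 0" using eq by (simp add: sum_subtractf)
    ultimately have "f i = g i" if "i \<in> I" for i using indep[of "\<lambda>i. f i - g i" i] that by simp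
    then show "f = g" by (rule PiE_ext[OF f g])
  qed
  show "(\<lambda>f. \<Sum>i\<in>I. f i) ` (\<Pi>\<^sub>E i\<in>I. D i) = G"
  proof
    show "(\<lambda>f. \<Sum>i\<in>I. f i) ` (\<Pi>\<^sub>E i\<in>I. D i) \<subseteq> G"
      using into by (auto simp: PiE_def)
    show "G \<subseteq> (\<lambda>f. \<Sum>i\<in>I. f i) ` (\<Pi>\<^sub>E i\<in>I. D i)"
    proof
      fix x assume "x \<in> G"
      then obtain f where f: "f \<in> Pi I D" "x = (\<Sum>i\<in>I. f i)" using onto by blast
      show "x \<in> (\<lambda>f. \<Sum>i\<in>I. f i) ` (\<Pi>\<^sub>E i\<in>I. D i)"
      proof (rule image_eqI)
        show "x = (\<Sum>i\<in>I. restrict f I i)" using f(2) by simp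
        show "restrict f I \<in> (\<Pi>\<^sub>E i\<in>I. D i)" using f(1) by (simp add: restrict_PiE_iff Pi_iff)
      qed
    qed
  qed
qed

lemma bij_betw_sum_pair:
  fixes D :: "nat \<Rightarrow> 'a::real_vector set"
  assumes sub: "subspace (D 0)" "subspace (D 1)" and int: "D 0 \<inter> D 1 = {0}"
    and G: "G = {x + y |x y. x \<in> D 0 \<and> y \<in> D 1}"
  shows "bij_betw (\<lambda>f. \<Sum>i\<in>{0, 1::nat}. f i) (\<Pi>\<^sub>E i\<in>{0, 1}. D i) G"
proof (rule bij_betw_sum_PiE)
  show "subspace (D i)" if "i \<in> {0, 1}" for i using that sub by blast
  show "(\<Sum>i\<in>{0, 1::nat}. f i) \<in> G" if "f \<in> Pi {0, 1} D" for f
    using that unfolding G by (auto simp: Pi_iff)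
  show "\<exists>f\<in>Pi {0, 1} D. x = (\<Sum>i\<in>{0, 1::nat}. f i)" if "x \<in> G" for x
  proof -
    obtain u v where "x = u + v" "u \<in> D 0" "v \<in> D 1" using \<open>x \<in> G\<close> G by blast
    then show ?thesis by (intro bexI[of _ "\<lambda>i. if i = 0 then u else v"]) (auto simp: Pi_iff)
  qed
  show "f i = 0" if f: "f \<in> Pi {0, 1} D" "(\<Sum>i\<in>{0, 1::nat}. f i) = 0" "i \<in> {0, 1}" for f i
  proof -
    have "f 0 + f 1 = 0" using f(2) by simp
    then have e: "f 0 = - f 1" by (rule eq_neg_iff_add_eq_0[THEN iffD2])
    moreover have "- f 1 \<in> D 1" using f(1) subspace_neg[OF sub(2)] by (simp add: Pi_iff)
    ultimately have "f 0 \<in> D 0 \<inter> D 1" using f(1) by (simp add: Pi_iff)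
    then have "f 0 = 0" unfolding int by simp
    moreover from this have "f 1 = 0" using e by simp
    ultimately show ?thesis using f(3) by (metis insertE singletonD)
  qed
qed

context symmetric_couple
begin

lemma sigma_closed: "x \<in> G \<Longrightarrow> \<sigma> x \<in> G"
  and sigma_add: "x \<in> G \<Longrightarrow> y \<in> G \<Longrightarrow> \<sigma> (x + y) = \<sigma> x + \<sigma> y"
  and sigma_scale: "x \<in> G \<Longrightarrow> \<sigma> (r *\<^sub>R x) = r *\<^sub>R \<sigma> x"
  and sigma_br: "x \<in> G \<Longrightarrow> y \<in> G \<Longrightarrow> \<sigma> (br x y) = br (\<sigma> x) (\<sigma> y)"
  using automorphism unfolding lie_automorphism_def bij_betw_def by auto

lemma sigma_zero: "\<sigma> 0 = 0"
  using sigma_scale[of 0 0] subspace_0[OF subspace] by simp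

lemma br_zero_right: "x \<in> G \<Longrightarrow> br x 0 = 0"
  using scale_right[of x 0 0] subspace_0[OF subspace] by simp

lemma anticommute:
  assumes "x \<in> G" "y \<in> G"
  shows "br x y = - br y x"
proof -
  have "0 = br (x + y) (x + y)" using alternating assms subspace_add[OF subspace] by simp
  also have "\<dots> = br x y + br y x"
    using assms subspace_add[OF subspace] alternating[OF assms(1)] alternating[OF assms(2)]
    by (simp add: add_left add_right)
  finally show ?thesis by (metis eq_neg_iff_add_eq_0)
qed

lemma minus_closed: "x \<in> G \<Longrightarrow> - x \<in> G"
  using subspace_neg[OF subspace] by simp

lemma br_neg_left: "x \<in> G \<Longrightarrow> y \<in> G \<Longrightarrow> br (- x) y = - br x y"
  using scale_left[of x y "-1"] by simp

lemma br_neg_right: "x \<in> G \<Longrightarrow> y \<in> G \<Longrightarrow> br x (- y) = - br x y"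
  using scale_right[of x y "-1"] by simp

lemma br_sum_right:
  assumes "x \<in> G" "\<And>i. i \<in> I \<Longrightarrow> h i \<in> G"
  shows "br x (\<Sum>i\<in>I. h i) = (\<Sum>i\<in>I. br x (h i))"
  using assms(2)
proof (induction I rule: infinite_finite_induct)
  case (insert i I)
  have "(\<Sum>i\<in>I. h i) \<in> G" by (rule subspace_sum[OF subspace]) (use insert in auto)
  then show ?case using insert add_right[OF assms(1)] by simp
qed (simp_all add: br_zero_right assms)

lemma sigma_sum:
  assumes "\<And>i. i \<in> I \<Longrightarrow> h i \<in> G"
  shows "\<sigma> (\<Sum>i\<in>I. h i) = (\<Sum>i\<in>I. \<sigma> (h i))"
  using assms
proof (induction I rule: infinite_finite_induct)
  case (insert i I)
  have "(\<Sum>i\<in>I. h i) \<in> G" by (rule subspace_sum[OF subspace]) (use insert in auto)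
  then show ?case using insert sigma_add by simp
qed (simp_all add: sigma_zero)

lemma br_left_mem_ideal:
  assumes "stable_ideal br \<sigma> G M" "x \<in> M" "y \<in> G"
  shows "br x y \<in> M"
  using anticommute[of x y] stable_idealD[OF assms(1)] assms(2,3) subspace_neg by metis

text \<open>
  Complementary ideals annihilate each other. Faithfulness passes to \<open>A\<close> because a fixed element
  of \<open>A\<close> acts trivially on the antifixed part of \<open>B\<close>. Likewise the brackets of antifixed
  elements of \<open>G\<close> split into one bracket from \<open>A\<close> and one from \<open>B\<close>, and a fixed element of \<open>A\<close>
  can only involve the former.
\<close>
lemma summand_symmetric_couple:
  assumes A: "stable_ideal br \<sigma> G A" and B: "stable_ideal br \<sigma> G B"
    and int: "A \<inter> B = {0}" and sum: "G = {x + y |x y. x \<in> A \<and> y \<in> B}"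
  shows "symmetric_couple br \<sigma> A"
proof -
  note AD = stable_idealD[OF A] and BD = stable_idealD[OF B]
  have cross: "br a b = 0" if "a \<in> A" "b \<in> B" for a b
  proof -
    have "br a b \<in> A \<inter> B"
      using br_left_mem_ideal[OF A that(1) BD(3)[OF that(2)]] BD(4)[OF AD(3)[OF that(1)] that(2)]
      by (rule IntI)
    then show ?thesis unfolding int by simp
  qed
  have cross': "br b a = 0" if "a \<in> A" "b \<in> B" for a b
    using cross[OF that] anticommute[OF BD(3)[OF that(2)] AD(3)[OF that(1)]] by simp
  have uniq: "a = a' \<and> b = b'" if "a + b = a' + b'" "a \<in> A" "a' \<in> A" "b \<in> B" "b' \<in> B" for a a' b b'
  proof -
    have e: "a - a' = b' - b" using that(1) by (simp add: algebra_simps)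
    have "a - a' \<in> A" by (rule subspace_diff[OF AD(1) that(2,3)])
    moreover have "a - a' \<in> B" unfolding e by (rule subspace_diff[OF BD(1) that(5,4)])
    ultimately have "a - a' \<in> {0}" unfolding int[symmetric] by blast
    then show ?thesis using e by simp
  qed
  have split: "\<exists>a b. y = a + b \<and> a \<in> antifixed_part \<sigma> A \<and> b \<in> antifixed_part \<sigma> B"
    if "y \<in> antifixed_part \<sigma> G" for y
  proof -
    have y: "y \<in> G" "\<sigma> y = - y" using that by (auto simp: antifixed_part_def)
    obtain a b where ab: "y = a + b" "a \<in> A" "b \<in> B" using y sum by blast
    have "\<sigma> a + \<sigma> b = - a + - b" using y ab sigma_add[of a b] AD(3) BD(3) by simp
    then have "\<sigma> a = - a \<and> \<sigma> b = - b"
      by (rule uniq) (use AD(5) BD(5) ab subspace_neg[OF AD(1)] subspace_neg[OF BD(1)] in simp_all)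
    then show ?thesis using ab by (auto simp: antifixed_part_def)
  qed
  define S where "S M = {br x y |x y. x \<in> antifixed_part \<sigma> M \<and> y \<in> antifixed_part \<sigma> M}" for M
  have SM: "span (S M) \<subseteq> fixed_part \<sigma> M" if "stable_ideal br \<sigma> G M" for M
  proof (rule span_minimal)
    note MD = stable_idealD[OF that]
    show "subspace (fixed_part \<sigma> M)" unfolding fixed_part_def
      using MD sigma_add sigma_scale sigma_zero
      by (auto intro!: subspaceI simp: subspace_0 subspace_add subspace_scale)
    show "S M \<subseteq> fixed_part \<sigma> M"
      unfolding S_def fixed_part_def antifixed_part_def
      using MD sigma_br br_neg_left br_neg_right minus_closed by auto
  qed
  have fixA: "fixed_part \<sigma> A \<subseteq> span (S A)"
  proof
    fix x assume x: "x \<in> fixed_part \<sigma> A"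
    have "S G \<subseteq> {a + b |a b. a \<in> span (S A) \<and> b \<in> span (S B)}"
    proof
      fix z assume "z \<in> S G"
      then obtain u v where uv: "z = br u v" "u \<in> antifixed_part \<sigma> G" "v \<in> antifixed_part \<sigma> G"
        unfolding S_def by blast
      obtain a b a' b' where d: "u = a + b" "a \<in> antifixed_part \<sigma> A" "b \<in> antifixed_part \<sigma> B"
        "v = a' + b'" "a' \<in> antifixed_part \<sigma> A" "b' \<in> antifixed_part \<sigma> B"
        using split uv by metis
      have m: "a \<in> A" "a' \<in> A" "b \<in> B" "b' \<in> B" using d by (auto simp: antifixed_part_def)
      then have m': "a \<in> G" "a' \<in> G" "b \<in> G" "b' \<in> G" using AD BD by auto
      have "z = br a a' + br b b'" unfolding uv d
        using m m' subspace_add[OF subspace] cross cross' by (simp add: add_left add_right)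
      moreover have "br a a' \<in> span (S A)" "br b b' \<in> span (S B)"
        using d by (auto simp: S_def intro!: span_base)
      ultimately show "z \<in> {a + b |a b. a \<in> span (S A) \<and> b \<in> span (S B)}" by blast
    qed
    then have "span (S G) \<subseteq> {a + b |a b. a \<in> span (S A) \<and> b \<in> span (S B)}"
      by (intro span_minimal subspace_sums) auto
    moreover have "x \<in> span (S G)"
      using x AD bracket_antifixed unfolding S_def fixed_part_def by auto
    ultimately obtain a b where ab: "x = a + b" "a \<in> span (S A)" "b \<in> span (S B)" by blast
    have "a \<in> A" "b \<in> B" "x \<in> A" using ab SM[OF A] SM[OF B] x by (auto simp: fixed_part_def)
    then have "x = a" using uniq[of x 0 a b] ab(1) subspace_0[OF BD(1)] by simp
    then show "x \<in> span (S A)" using ab by simp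
  qed
  have fd: "\<exists>F. finite F \<and> span F = A"
  proof -
    obtain F where F: "finite F" "span F = G"
      using finite_dimensional by metis
    obtain b where b: "b \<subseteq> A" "independent b" "A \<subseteq> span b"
      using real_vector.basis_exists[of A] by metis
    have "b \<subseteq> span F" unfolding F(2) using b(1) AD(2) by (rule order_trans)
    then have "finite b" using independent_span_bound[OF F(1) b(2)] by simp
    moreover have "span b = A" using span_minimal[OF b(1) AD(1)] b(3) by (rule subset_antisym)
    ultimately show ?thesis by blast
  qed
  show ?thesis
  proof (unfold_locales)
    show "subspace A" by (rule AD(1))
    show "\<exists>F. finite F \<and> span F = A" by (rule fd)
    show "lie_automorphism br A \<sigma>" unfolding lie_automorphism_def
    proof (intro conjI)
      show "bij_betw \<sigma> A A"
        by (rule bij_betw_byWitness[of _ \<sigma>]) (use AD involutive in auto)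
    qed (use AD sigma_add sigma_scale sigma_br in auto)
    show "x = 0" if x: "x \<in> fixed_part \<sigma> A" and z: "\<And>y. y \<in> antifixed_part \<sigma> A \<Longrightarrow> br x y = 0" for x
    proof (rule faithful)
      have xA: "x \<in> A" using x by (simp add: fixed_part_def)
      show "x \<in> fixed_part \<sigma> G" using x AD by (auto simp: fixed_part_def)
      fix y assume "y \<in> antifixed_part \<sigma> G"
      then obtain a b where ab: "y = a + b" "a \<in> antifixed_part \<sigma> A" "b \<in> antifixed_part \<sigma> B"
        using split by blast
      have "a \<in> A" "b \<in> B" using ab by (auto simp: antifixed_part_def)
      then show "br x y = 0" using ab z xA cross AD(3) BD(3) by (simp add: add_right)
    qed
    show "span {br x y |x y. x \<in> antifixed_part \<sigma> A \<and> y \<in> antifixed_part \<sigma> A} = fixed_part \<sigma> A"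
      using SM[OF A] fixA unfolding S_def by blast
  qed (use AD in \<open>auto simp: add_left add_right scale_left scale_right alternating jacobi involutive\<close>)
qed

lemma decomposable_if_stable_summands:
  assumes A: "stable_ideal br \<sigma> G A" and B: "stable_ideal br \<sigma> G B"
    and int: "A \<inter> B = {0}" and sum: "G = {x + y |x y. x \<in> A \<and> y \<in> B}"
    and nz: "A \<noteq> {0}" "B \<noteq> {0}"
  shows "decomposable br \<sigma> G"
proof -
  define D where "D = (\<lambda>i::nat. if i = 0 then A else B)"
  have "{x + y |x y. x \<in> A \<and> y \<in> B} = {x + y |x y. x \<in> B \<and> y \<in> A}"
    by (rule Collect_cong) (metis add.commute)
  with sum have sum': "G = {x + y |x y. x \<in> B \<and> y \<in> A}" by (rule trans)
  have int': "B \<inter> A = {0}" using int by (simp only: Int_commute)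
  have "bij_betw (\<lambda>f. \<Sum>i\<in>{0, 1::nat}. f i) (\<Pi>\<^sub>E i\<in>{0, 1}. D i) G"
  proof (rule bij_betw_sum_pair)
    show "subspace (D 0)" "subspace (D 1)"
      using stable_idealD(1)[OF A] stable_idealD(1)[OF B] by (simp_all add: D_def)
    show "D 0 \<inter> D 1 = {0}" using int by (simp add: D_def)
    show "G = {x + y |x y. x \<in> D 0 \<and> y \<in> D 1}" unfolding D_def using sum by simp
  qed
  moreover have "lie_ideal br G (D i) \<and> \<sigma> ` D i \<subseteq> D i \<and> symmetric_couple br \<sigma> (D i)" for i
    using A B summand_symmetric_couple[OF A B int sum] summand_symmetric_couple[OF B A int' sum']
    by (simp add: D_def stable_ideal_def)
  ultimately have "couple_direct_sum br \<sigma> G {0, 1::nat} D"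
    unfolding couple_direct_sum_def by blast
  moreover have "D 0 \<noteq> {0}" "D 1 \<noteq> {0}" using nz by (simp_all add: D_def)
  ultimately show ?thesis unfolding decomposable_def by blast
qed

section \<open>Fitting's lemma\<close>

lemma stable_ideal_kernel:
  assumes g: "equivariant br \<sigma> G G G g"
  shows "stable_ideal br \<sigma> G {x \<in> G. g x = 0}"
  unfolding stable_ideal_def lie_ideal_def
proof (intro conjI)
  note gD = equivariantD[OF g] equivariant_zero[OF g subspace]
  show "subspace {x \<in> G. g x = 0}"
    using subspace_0[OF subspace] subspace_add[OF subspace] subspace_scale[OF subspace]
    by (intro subspaceI) (simp_all add: gD(2,3,6))
  show "\<forall>x\<in>G. \<forall>y\<in>{x \<in> G. g x = 0}. br x y \<in> {x \<in> G. g x = 0}"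
    using closed by (simp add: gD(4) br_zero_right)
  show "\<sigma> ` {x \<in> G. g x = 0} \<subseteq> {x \<in> G. g x = 0}"
    by (rule image_subsetI) (simp add: gD(5) sigma_closed sigma_zero)
qed simp

lemma stable_ideal_image:
  assumes g: "equivariant br \<sigma> G G G g"
  shows "stable_ideal br \<sigma> G (g ` G)"
  unfolding stable_ideal_def lie_ideal_def
proof (intro conjI)
  note gD = equivariantD[OF g] equivariant_zero[OF g subspace]
  show "subspace (g ` G)"
  proof (rule subspaceI)
    show "0 \<in> g ` G" using gD(6) subspace_0[OF subspace] by (metis imageI)
    show "x + y \<in> g ` G" if xy: "x \<in> g ` G" "y \<in> g ` G" for x y
    proof -
      obtain u v where "u \<in> G" "v \<in> G" "x = g u" "y = g v" using xy by (elim imageE) simp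
      then show ?thesis using gD(2) subspace_add[OF subspace] by (metis imageI)
    qed
    show "c *\<^sub>R x \<in> g ` G" if x: "x \<in> g ` G" for x c
    proof -
      obtain u where "u \<in> G" "x = g u" using x by (rule imageE)
      then show ?thesis using gD(3) subspace_scale[OF subspace] by (metis imageI)
    qed
  qed
  show "g ` G \<subseteq> G" using gD(1) by (rule image_subsetI)
  show "\<forall>x\<in>G. \<forall>y\<in>g ` G. br x y \<in> g ` G"
    using gD(4) closed by (auto simp flip: gD(4))
  show "\<sigma> ` g ` G \<subseteq> g ` G"
    using sigma_closed by (auto simp flip: gD(5))
qed

text \<open>
  The kernel and the image of \<open>f ^^ n\<close> are stable ideals. As \<open>G\<close> is finite-dimensional, they are
  constant for large \<open>n\<close>, and then \<open>G\<close> is their direct sum; so one of them vanishes.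
\<close>
lemma indecomposable_endo_cases:
  assumes f: "equivariant br \<sigma> G G G f" and ind: "indecomposable br \<sigma> G"
  obtains "bij_betw f G G" | n where "\<And>x. x \<in> G \<Longrightarrow> (f ^^ n) x = 0"
proof -
  define Ker Im where "Ker n = {x \<in> G. (f ^^ n) x = 0}" and "Im n = (f ^^ n) ` G" for n
  note fn = equivariant_funpow[OF f]
  have fn_mem: "(f ^^ n) x \<in> G" if "x \<in> G" for n x using equivariantD(1)[OF fn] that .
  have fn_zero: "(f ^^ n) 0 = 0" for n using equivariant_zero[OF fn subspace] .
  have Ker: "stable_ideal br \<sigma> G (Ker n)" for n
    unfolding Ker_def by (rule stable_ideal_kernel[OF fn])
  have Im: "stable_ideal br \<sigma> G (Im n)" for n
    unfolding Im_def by (rule stable_ideal_image[OF fn])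
  obtain F where F: "finite F" "span F = G"
      using finite_dimensional by metis
  have pow: "(f ^^ (m + k)) x = (f ^^ m) ((f ^^ k) x)" for m k x by (simp add: funpow_add)
  have "\<exists>k. \<forall>m\<ge>k. Ker m = Ker k"
  proof (rule increasing_subspaces_stabilize[OF _ _ F(1)])
    show "Ker m \<subseteq> Ker n" if "m \<le> n" for m n
      using that pow[of "n - m" m] fn_zero by (auto simp: Ker_def)
    show "subspace (Ker m)" for m by (rule stable_idealD(1)[OF Ker])
    show "Ker m \<subseteq> span F" for m unfolding F(2) by (rule stable_idealD(2)[OF Ker])
  qed
  then obtain k where k: "\<And>m. m \<ge> k \<Longrightarrow> Ker m = Ker k" by blast
  have "\<exists>l. \<forall>m\<ge>l. Im m = Im l"
  proof (rule decreasing_subspaces_stabilize[OF _ _ F(1)])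
    show "Im n \<subseteq> Im m" if "m \<le> n" for m n
      using that pow[of m "n - m"] fn_mem by (auto simp: Im_def)
    show "subspace (Im m)" for m by (rule stable_idealD(1)[OF Im])
    show "Im m \<subseteq> span F" for m unfolding F(2) by (rule stable_idealD(2)[OF Im])
  qed
  then obtain l where l: "\<And>m. m \<ge> l \<Longrightarrow> Im m = Im l" by blast
  \<comment> \<open>The successor makes \<open>n\<close> positive, so that the kernel of \<open>f ^^ n\<close> contains that of \<open>f\<close>
    and the image of \<open>f\<close> contains that of \<open>f ^^ n\<close>.\<close>
  define n where "n = Suc (k + l)"
  have Kn: "Ker (n + n) = Ker n" using k[of n] k[of "n + n"] unfolding n_def by simp
  have In: "Im (n + n) = Im n" using l[of n] l[of "n + n"] unfolding n_def by simp
  have int: "Ker n \<inter> Im n = {0}"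
  proof -
    have "y = 0" if y: "y \<in> Ker n" "y \<in> Im n" for y
    proof -
      obtain x where x: "x \<in> G" "y = (f ^^ n) x" using y(2) by (auto simp: Im_def)
      have "x \<in> Ker (n + n)" using y x pow[of n n x] by (simp add: Ker_def)
      then have "x \<in> Ker n" unfolding Kn .
      then show ?thesis using x by (simp add: Ker_def)
    qed
    moreover have "0 \<in> Ker n" "0 \<in> Im n"
      using subspace_0[OF stable_idealD(1)[OF Ker]] subspace_0[OF stable_idealD(1)[OF Im]] .
    ultimately show ?thesis by auto
  qed
  have sum: "G = {x + y |x y. x \<in> Ker n \<and> y \<in> Im n}"
  proof
    show "G \<subseteq> {x + y |x y. x \<in> Ker n \<and> y \<in> Im n}"
    proof
      fix x assume x: "x \<in> G"
      then have "(f ^^ n) x \<in> Im (n + n)" using In by (auto simp: Im_def)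
      then obtain y where y: "y \<in> G" "(f ^^ n) x = (f ^^ n) ((f ^^ n) y)"
        using pow unfolding Im_def by auto
      have "x - (f ^^ n) y \<in> Ker n" unfolding Ker_def
        using x y fn_mem equivariant_diff[OF fn subspace] subspace_diff[OF subspace] by simp
      moreover have "(f ^^ n) y \<in> Im n" using y by (simp add: Im_def)
      moreover have "x = (x - (f ^^ n) y) + (f ^^ n) y" by simp
      ultimately show "x \<in> {x + y |x y. x \<in> Ker n \<and> y \<in> Im n}" by blast
    qed
    show "{x + y |x y. x \<in> Ker n \<and> y \<in> Im n} \<subseteq> G"
      using stable_idealD(3)[OF Ker] stable_idealD(3)[OF Im] subspace_add[OF subspace] by blast
  qed
  have "Ker n = {0} \<or> Im n = {0}"
    using decomposable_if_stable_summands[OF Ker Im int sum] ind by blast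
  then show ?thesis
  proof
    assume K: "Ker n = {0}"
    have "inj_on f G"
    proof (rule equivariant_inj_onI[OF f subspace])
      fix x assume x: "x \<in> G" "f x = 0"
      then have "x \<in> Ker n" using fn_zero[of "k + l"] by (simp add: Ker_def n_def funpow_swap1)
      then show "x = 0" using K by simp
    qed
    moreover have "f ` G = G"
    proof
      show "f ` G \<subseteq> G" using equivariantD(1)[OF f] by auto
      show "G \<subseteq> f ` G"
      proof
        fix x assume "x \<in> G"
        then obtain y z where "x = y + z" "y \<in> Ker n" "z \<in> Im n" using sum by blast
        then have "x \<in> Im n" using K by simp
        then show "x \<in> f ` G" using fn_mem[of _ "k + l"] by (auto simp: Im_def n_def)
      qed
    qed
    ultimately show ?thesis using that(1) by (simp add: bij_betw_def)
  next
    assume "Im n = {0}"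
    then show ?thesis using that(2)[of n] by (auto simp: Im_def)
  qed
qed

lemma inj_endo_bij:
  assumes f: "equivariant br \<sigma> G G G f" and ind: "indecomposable br \<sigma> G" and inj: "inj_on f G"
  shows "bij_betw f G G"
  using f ind
proof (cases rule: indecomposable_endo_cases)
  case (2 n)
  have "inj_on (f ^^ n) G" using inj
  proof (induction n)
    case (Suc n)
    show ?case using comp_inj_on[of "f ^^ n" G f] Suc equivariantD(1)[OF equivariant_funpow[OF f]]
      by (metis funpow.simps(2) image_subsetI inj_on_subset)
  qed simp
  then have "x = 0" if "x \<in> G" for x
    using 2 that subspace_0[OF subspace] by (metis inj_onD)
  then have "G = {0}" using subspace_0[OF subspace] by auto
  then show ?thesis using equivariant_zero[OF f subspace] by (auto simp: bij_betw_def)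
qed

lemma equivariant_inverse:
  assumes u: "equivariant br \<sigma> G G G u" and b: "bij_betw u G G"
  shows "equivariant br \<sigma> G G G (the_inv_into G u)"
proof -
  let ?v = "the_inv_into G u"
  have inj: "inj_on u G" and im: "u ` G = G" using b by (auto simp: bij_betw_def)
  have v: "?v x \<in> G" "u (?v x) = x" if "x \<in> G" for x
    using that im the_inv_into_into[OF inj] f_the_inv_into_f[OF inj] by auto
  have vI: "?v y = x" if "u x = y" "x \<in> G" for x y
    using the_inv_into_f_eq[OF inj that(1,2)] .
  note uD = equivariantD[OF u]
  show ?thesis unfolding equivariant_def
  proof (intro conjI ballI allI Pi_I)
    fix x y r assume x: "x \<in> G" and y: "y \<in> G"
    show "?v (x + y) = ?v x + ?v y"
      by (rule vI) (simp_all add: uD(2) v x y subspace_add[OF subspace])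
    show "?v (br x y) = br x (?v y)" by (rule vI) (simp_all add: uD(4) v x y closed)
  next
    fix x r assume x: "x \<in> G"
    show "?v x \<in> G" using v(1)[OF x] .
    show "?v (r *\<^sub>R x) = r *\<^sub>R ?v x"
      by (rule vI) (simp_all add: uD(3) v x subspace_scale[OF subspace])
    show "?v (\<sigma> x) = \<sigma> (?v x)" by (rule vI) (simp_all add: uD(5) v x sigma_closed)
  qed
qed

text \<open>
  After composition with the inverse of \<open>f + g\<close> the two terms add up to the identity. If the first
  is nilpotent, then it cannot fix a nonzero vector, which it would have to do on the kernel of \<open>g\<close>.
\<close>
lemma inj_summand_of_inj_sum:
  assumes f: "equivariant br \<sigma> G G G f" and g: "equivariant br \<sigma> G G G g"
    and ind: "indecomposable br \<sigma> G" and inj: "inj_on (\<lambda>x. f x + g x) G"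
  shows "inj_on f G \<or> inj_on g G"
proof -
  let ?u = "\<lambda>x. f x + g x"
  let ?v = "the_inv_into G ?u"
  have u: "equivariant br \<sigma> G G G ?u"
    using equivariantD[OF f] equivariantD[OF g] subspace_add[OF subspace] add_right sigma_add
    unfolding equivariant_def by (auto simp: algebra_simps)
  have v: "equivariant br \<sigma> G G G ?v"
    using equivariant_inverse[OF u inj_endo_bij[OF u ind inj]] .
  have vf: "equivariant br \<sigma> G G G (\<lambda>x. ?v (f x))" using equivariant_comp[OF f v] .
  have one: "?v (f x) + ?v (g x) = x" if "x \<in> G" for x
    using equivariantD(2)[OF v] equivariantD(1)[OF f] equivariantD(1)[OF g]
      the_inv_into_f_f[OF inj] that by metis
  show ?thesis using vf ind
  proof (cases rule: indecomposable_endo_cases)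
    case 1
    then have "inj_on (?v \<circ> f) G" by (simp add: bij_betw_def comp_def)
    then show ?thesis using inj_on_imageI2 by blast
  next
    case (2 n)
    have "inj_on g G"
    proof (rule equivariant_inj_onI[OF g subspace])
      fix x assume x: "x \<in> G" "g x = 0"
      then have "?v (f x) = x" using one[OF x(1)] equivariant_zero[OF v subspace] by simp
      then have "((\<lambda>x. ?v (f x)) ^^ m) x = x" for m by (induction m) auto
      then show "x = 0" using 2 x by metis
    qed
    then show ?thesis ..
  qed
qed

lemma inj_member_of_inj_sum:
  assumes "finite J" "\<And>j. j \<in> J \<Longrightarrow> equivariant br \<sigma> G G G (f j)"
    and ind: "indecomposable br \<sigma> G" and nz: "G \<noteq> {0}" and "inj_on (\<lambda>x. \<Sum>j\<in>J. f j x) G"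
  shows "\<exists>j\<in>J. inj_on (f j) G"
  using assms(1,2,5)
proof (induction J rule: finite_induct)
  case empty
  then show ?case using nz subspace_0[OF subspace] by (auto simp: inj_on_def)
next
  case (insert j J)
  have s: "equivariant br \<sigma> G G G (\<lambda>x. \<Sum>j\<in>J. f j x)"
    using equivariantD[OF insert.prems(1)]
    unfolding equivariant_def
    by (auto simp: br_sum_right sigma_sum sum.distrib scaleR_sum_right
        intro!: subspace_sum[OF subspace])
  have "inj_on (\<lambda>x. f j x + (\<Sum>j\<in>J. f j x)) G" using insert by simp
  then show ?case using inj_summand_of_inj_sum[OF insert.prems(1) s ind] insert by auto
qed

end

section \<open>Components of a direct sum\<close>

text \<open>
  The projection onto the \<open>i\<close>-th summand, obtained by inverting the bijection in
  \<open>couple_direct_sum\<close>. It is meaningful only on the sum of the \<open>D i\<close>.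
\<close>
definition component :: "'i set \<Rightarrow> ('i \<Rightarrow> 'a::real_vector set) \<Rightarrow> 'i \<Rightarrow> 'a \<Rightarrow> 'a" where
  "component I D i x = the_inv_into (\<Pi>\<^sub>E i\<in>I. D i) (\<lambda>f. \<Sum>i\<in>I. f i) x i"

context symmetric_couple
begin

context
  fixes I :: "'i set" and D :: "'i \<Rightarrow> 'a set"
  assumes sum_D: "couple_direct_sum br \<sigma> G I D"
begin

lemma direct_sum_finite: "finite I"
  and direct_sum_ideal: "i \<in> I \<Longrightarrow> stable_ideal br \<sigma> G (D i)"
  and direct_sum_couple: "i \<in> I \<Longrightarrow> symmetric_couple br \<sigma> (D i)"
  and direct_sum_bij: "bij_betw (\<lambda>f. \<Sum>i\<in>I. f i) (\<Pi>\<^sub>E i\<in>I. D i) G"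
  using sum_D by (simp_all add: couple_direct_sum_def stable_ideal_def)

lemma direct_sum_mem: "i \<in> I \<Longrightarrow> x \<in> D i \<Longrightarrow> x \<in> G"
  using stable_idealD(3)[OF direct_sum_ideal] .

lemma direct_sum_zero: "i \<in> I \<Longrightarrow> 0 \<in> D i"
  using subspace_0[OF stable_idealD(1)[OF direct_sum_ideal]] .

lemma component_mem:
  assumes "x \<in> G" "i \<in> I"
  shows "component I D i x \<in> D i"
proof -
  have "the_inv_into (\<Pi>\<^sub>E i\<in>I. D i) (\<lambda>f. \<Sum>i\<in>I. f i) x \<in> (\<Pi>\<^sub>E i\<in>I. D i)"
    using bij_betwE[OF bij_betw_the_inv_into[OF direct_sum_bij]] assms(1) by blast
  then show ?thesis unfolding component_def using assms(2) by (rule PiE_mem)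
qed

lemma component_in: "x \<in> G \<Longrightarrow> i \<in> I \<Longrightarrow> component I D i x \<in> G"
  by (rule direct_sum_mem[OF _ component_mem])

lemma sum_components: "x \<in> G \<Longrightarrow> (\<Sum>i\<in>I. component I D i x) = x"
  unfolding component_def using f_the_inv_into_f_bij_betw[OF direct_sum_bij] by blast

lemma component_sum:
  assumes "\<And>i. i \<in> I \<Longrightarrow> f i \<in> D i" "i \<in> I"
  shows "component I D i (\<Sum>i\<in>I. f i) = f i"
proof -
  have "restrict f I \<in> (\<Pi>\<^sub>E i\<in>I. D i)" using assms(1) by (simp add: restrict_PiE_iff)
  then have "the_inv_into (\<Pi>\<^sub>E i\<in>I. D i) (\<lambda>f. \<Sum>i\<in>I. f i) (\<Sum>i\<in>I. restrict f I i) = restrict f I"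
    using the_inv_into_f_f[OF bij_betw_imp_inj_on[OF direct_sum_bij]] by blast
  then show ?thesis unfolding component_def using assms(2) by simp
qed

text \<open>
  Uniqueness of the components gives all their properties: it suffices to exhibit a family with
  the right sum.
\<close>
lemma component_eqI:
  assumes "\<And>j. j \<in> I \<Longrightarrow> f j \<in> D j" "(\<Sum>j\<in>I. f j) = x" "i \<in> I"
  shows "component I D i x = f i"
  using component_sum[of f i] assms by simp

lemma eq_if_components_eq:
  assumes "x \<in> G" "y \<in> G" "\<And>i. i \<in> I \<Longrightarrow> component I D i x = component I D i y"
  shows "x = y"
proof -
  have "(\<Sum>i\<in>I. component I D i x) = (\<Sum>i\<in>I. component I D i y)"
    using assms(3) by (rule sum.cong[OF refl])
  then show ?thesis using sum_components[OF assms(1)] sum_components[OF assms(2)] by simp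
qed

lemma component_of_summand:
  assumes "j \<in> I" "x \<in> D j" "i \<in> I"
  shows "component I D i x = (if i = j then x else 0)"
proof (rule component_eqI[where f = "\<lambda>i. if i = j then x else 0"])
  show "(\<Sum>i\<in>I. if i = j then x else 0) = x"
    using direct_sum_finite assms(1) by simp
qed (use assms direct_sum_zero in auto)

lemma component_equivariant:
  assumes i: "i \<in> I"
  shows "equivariant br \<sigma> G G (D i) (component I D i)"
  unfolding equivariant_def
proof (intro conjI ballI allI Pi_I)
  fix x y assume x: "x \<in> G" and y: "y \<in> G"
  show "component I D i (x + y) = component I D i x + component I D i y"
    by (rule component_eqI[where f = "\<lambda>i. component I D i x + component I D i y"])
      (use x y i component_mem subspace_add[OF stable_idealD(1)[OF direct_sum_ideal]]
        in \<open>simp_all add: sum.distrib sum_components\<close>)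
  show "component I D i (br x y) = br x (component I D i y)"
    by (rule component_eqI[where f = "\<lambda>i. br x (component I D i y)"])
      (use x y i component_mem component_in stable_idealD(4)[OF direct_sum_ideal]
        in \<open>simp_all add: sum_components flip: br_sum_right\<close>)
next
  fix x and r :: real assume x: "x \<in> G"
  show "component I D i x \<in> D i" using component_mem[OF x i] .
  show "component I D i (r *\<^sub>R x) = r *\<^sub>R component I D i x"
    by (rule component_eqI[where f = "\<lambda>i. r *\<^sub>R component I D i x"])
      (use x i component_mem subspace_scale[OF stable_idealD(1)[OF direct_sum_ideal]]
        in \<open>simp_all add: sum_components flip: scaleR_sum_right\<close>)
  show "component I D i (\<sigma> x) = \<sigma> (component I D i x)"
    by (rule component_eqI[where f = "\<lambda>i. \<sigma> (component I D i x)"])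
      (use x i component_mem component_in stable_idealD(5)[OF direct_sum_ideal]
        in \<open>simp_all add: sum_components flip: sigma_sum\<close>)
qed

text \<open>
  Equivariance in the second argument and anticommutativity give equivariance in the first. As
  the component is idempotent, it can be moved onto both arguments.
\<close>
lemma component_br:
  assumes x: "x \<in> G" and y: "y \<in> G" and i: "i \<in> I"
  shows "component I D i (br x y) = br (component I D i x) (component I D i y)"
proof -
  let ?c = "component I D i"
  note cD = equivariantD[OF component_equivariant[OF i]]
  note cx = component_in[OF x i] and cy = component_in[OF y i]
  have "?c (br x y) = ?c (?c (br x y))"
    using component_of_summand[OF i component_mem[OF closed[OF x y] i] i] by simp
  also have "\<dots> = ?c (br (- ?c y) x)"
    using anticommute[OF x cy] by (simp add: cD(4) x y br_neg_left cy)
  also have "\<dots> = - br (?c y) (?c x)"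
    using cD(4)[OF minus_closed[OF cy] x] by (simp add: br_neg_left cx cy)
  also have "\<dots> = br (?c x) (?c y)" using anticommute[OF cx cy] by simp
  finally show ?thesis .
qed

text \<open>
  The kernel of the \<open>i\<close>-th component is the sum of the other summands, and an ideal mapped
  bijectively onto \<open>D i\<close> is another complement of this kernel.
\<close>
lemma direct_sum_exchange:
  assumes i: "i \<in> I" and E: "stable_ideal br \<sigma> G E" and cE: "symmetric_couple br \<sigma> E"
    and bij: "bij_betw (component I D i) E (D i)"
  shows "couple_direct_sum br \<sigma> G I (D(i := E))"
proof -
  let ?c = "component I D"
  note ceq = component_equivariant[OF i]
  have EG: "x \<in> G" if "x \<in> E" for x using stable_idealD(3)[OF E that] .
  have mem: "f j \<in> G" if "f \<in> Pi I (D(i := E))" "j \<in> I" for f j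
    using that EG direct_sum_mem[of j "f j"] by (auto simp: Pi_iff split: if_splits)
  have "bij_betw (\<lambda>f. \<Sum>j\<in>I. f j) (\<Pi>\<^sub>E j\<in>I. (D(i := E)) j) G"
  proof (rule bij_betw_sum_PiE)
    show "subspace ((D(i := E)) j)" if "j \<in> I" for j
      using stable_idealD(1)[OF E] stable_idealD(1)[OF direct_sum_ideal[OF that]] by simp
    show "(\<Sum>j\<in>I. f j) \<in> G" if "f \<in> Pi I (D(i := E))" for f
      by (rule subspace_sum[OF subspace]) (rule mem[OF that])
    show "\<exists>f\<in>Pi I (D(i := E)). x = (\<Sum>j\<in>I. f j)" if x: "x \<in> G" for x
    proof -
      have "?c i x \<in> ?c i ` E" using bij component_mem[OF x i] by (simp add: bij_betw_def)
      then obtain w where w: "?c i x = ?c i w" "w \<in> E" by (rule imageE)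
      note d = subspace_diff[OF subspace x EG[OF w(2)]]
      have z: "?c i (x - w) = 0"
        using equivariant_diff[OF ceq subspace x EG[OF w(2)]] w(1) by simp
      \<comment> \<open>Once \<open>w\<close> has absorbed the \<open>i\<close>-th component, the rest lies in the other summands.\<close>
      let ?f = "\<lambda>j. if j = i then w else ?c j (x - w)"
      have "(\<Sum>j\<in>I. ?f j) = w + (\<Sum>j\<in>I - {i}. ?c j (x - w))"
        using direct_sum_finite i by (simp add: sum.remove)
      also have "(\<Sum>j\<in>I - {i}. ?c j (x - w)) = (\<Sum>j\<in>I. ?c j (x - w))"
        using direct_sum_finite i z by (simp add: sum.remove[of I i])
      also have "\<dots> = x - w" by (rule sum_components[OF d])
      finally have "x = (\<Sum>j\<in>I. ?f j)" by simp
      moreover have "?f \<in> Pi I (D(i := E))" using w(2) component_mem[OF d] by auto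
      ultimately show ?thesis by blast
    qed
    show "f j = 0" if f: "f \<in> Pi I (D(i := E))" "(\<Sum>j\<in>I. f j) = 0" "j \<in> I" for f j
    proof -
      have fi: "f i \<in> E" using f(1) i by (auto simp: Pi_iff)
      have fj: "f j \<in> D j" if "j \<in> I" "j \<noteq> i" for j using f(1) that by (auto simp: Pi_iff)
      have "0 = ?c i (\<Sum>j\<in>I. f j)" using f(2) equivariant_zero[OF ceq subspace] by simp
      also have "\<dots> = (\<Sum>j\<in>I. ?c i (f j))" by (rule equivariant_sum[OF ceq subspace mem[OF f(1)]])
      also have "\<dots> = (\<Sum>j\<in>I. if j = i then ?c i (f i) else 0)"
        using component_of_summand[OF _ fj i] by (intro sum.cong[OF refl]) auto
      also have "\<dots> = ?c i (f i)" using direct_sum_finite i by simp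
      finally have "?c i (f i) = ?c i 0" using equivariant_zero[OF ceq subspace] by simp
      then have fi0: "f i = 0"
        using inj_onD[OF bij_betw_imp_inj_on[OF bij]] fi subspace_0[OF stable_idealD(1)[OF E]] by blast
      have "component I D j 0 = f j"
        by (rule component_eqI) (use f(2,3) fj fi0 direct_sum_zero[OF i] in metis)+
      then show ?thesis using equivariant_zero[OF component_equivariant[OF f(3)] subspace] by simp
    qed
  qed
  moreover have "lie_ideal br G ((D(i := E)) j) \<and> \<sigma> ` (D(i := E)) j \<subseteq> (D(i := E)) j
      \<and> symmetric_couple br \<sigma> ((D(i := E)) j)" if "j \<in> I" for j
    using E cE direct_sum_ideal[OF that] direct_sum_couple[OF that] by (simp add: stable_ideal_def)
  ultimately show ?thesis unfolding couple_direct_sum_def using direct_sum_finite by blast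
qed

end

section \<open>Matching the summands of two decompositions\<close>

text \<open>
  By Fitting's lemma \<open>g \<circ> f\<close> is bijective. The powers of \<open>f \<circ> g\<close> cannot vanish, since
  \<open>(g \<circ> f) ^^ Suc n = g \<circ> (f \<circ> g) ^^ n \<circ> f\<close>; so \<open>f \<circ> g\<close> is bijective too.
\<close>
lemma mutual_bij:
  assumes M: "symmetric_couple br \<sigma> M" "M \<subseteq> G" "indecomposable br \<sigma> M" "M \<noteq> {0}"
    and N: "symmetric_couple br \<sigma> N" "N \<subseteq> G" "indecomposable br \<sigma> N"
    and f: "equivariant br \<sigma> G M N f" and g: "equivariant br \<sigma> G N M g"
    and inj: "inj_on (\<lambda>x. g (f x)) M"
  shows "bij_betw f M N \<and> bij_betw g N M"
proof -
  interpret M: symmetric_couple br \<sigma> M by (rule M(1))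
  interpret N: symmetric_couple br \<sigma> N by (rule N(1))
  have gf: "equivariant br \<sigma> M M M (\<lambda>x. g (f x))"
    by (rule equivariant_subset[OF equivariant_comp[OF f g] M(2) order_refl])
  have fg: "equivariant br \<sigma> N N N (\<lambda>y. f (g y))"
    by (rule equivariant_subset[OF equivariant_comp[OF g f] N(2) order_refl])
  have bgf: "bij_betw (\<lambda>x. g (f x)) M M" by (rule M.inj_endo_bij[OF gf M(3) inj])
  show ?thesis using fg N(3)
  proof (cases rule: N.indecomposable_endo_cases)
    case 1
    have "inj_on (g \<circ> f) M" "inj_on (f \<circ> g) N"
      using bgf 1 by (simp_all add: bij_betw_def comp_def)
    then have "inj_on f M" "inj_on g N" by (blast dest: inj_on_imageI2)+
    moreover have "f ` M = N"
    proof
      show "f ` M \<subseteq> N" using equivariantD(1)[OF f] by (rule image_subsetI)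
      have "N = f ` g ` N" using 1 by (simp add: bij_betw_def image_image)
      also have "\<dots> \<subseteq> f ` M" using equivariantD(1)[OF g] by (intro image_mono image_subsetI)
      finally show "N \<subseteq> f ` M" .
    qed
    moreover have "g ` N = M"
    proof
      show "g ` N \<subseteq> M" using equivariantD(1)[OF g] by (rule image_subsetI)
      have "M = g ` f ` M" using bgf by (simp add: bij_betw_def image_image)
      also have "\<dots> \<subseteq> g ` N" using equivariantD(1)[OF f] by (intro image_mono image_subsetI)
      finally show "M \<subseteq> g ` N" .
    qed
    ultimately show ?thesis by (simp add: bij_betw_def)
  next
    case (2 n)
    have pow: "((\<lambda>x. g (f x)) ^^ Suc n) x = g (((\<lambda>y. f (g y)) ^^ n) (f x))" for n x
      by (induction n) simp_all
    have "x = 0" if x: "x \<in> M" for x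
    proof -
      have "((\<lambda>x. g (f x)) ^^ Suc n) x = ((\<lambda>x. g (f x)) ^^ Suc n) 0"
        unfolding pow using 2 equivariantD(1)[OF f] x subspace_0[OF M.subspace] by simp
      then show ?thesis
        using bij_betw_imp_inj_on[OF bij_betw_funpow[OF bgf]] x subspace_0[OF M.subspace]
        by (metis inj_onD)
    qed
    then have "M = {0}" using subspace_0[OF M.subspace] by blast
    then show ?thesis using M(4) by simp
  qed
qed

lemma flat_if_inj_into_flat:
  assumes f: "equivariant br \<sigma> G M N f" and M: "subspace M" and inj: "inj_on f M" and N: "flat \<sigma> N"
  shows "flat \<sigma> M"
proof -
  have "x = 0" if "x \<in> fixed_part \<sigma> M" for x
  proof -
    have x: "x \<in> M" "\<sigma> x = x" using that by (simp_all add: fixed_part_def)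
    have "f x \<in> fixed_part \<sigma> N"
      using equivariantD(1,5)[OF f x(1)] x(2) by (simp add: fixed_part_def)
    then have "f x = f 0" using N equivariant_zero[OF f M] by (simp add: flat_def)
    then show ?thesis using inj_onD[OF inj] x(1) subspace_0[OF M] by blast
  qed
  moreover have "0 \<in> fixed_part \<sigma> M" using subspace_0[OF M] sigma_zero by (simp add: fixed_part_def)
  ultimately show ?thesis unfolding flat_def by blast
qed

lemma flat_zero: "flat \<sigma> {0}"
  using sigma_zero by (auto simp: flat_def fixed_part_def)

text \<open>
  The identity of \<open>D i\<close> is the sum over \<open>k\<close> of the projection to \<open>C' k\<close> followed by the one back to
  \<open>D i\<close>, so one of these round trips is injective. A flat partner is impossible: its
  fixed part is zero, and so would be that of \<open>D i\<close>.
\<close>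
lemma matching_summand:
  assumes D: "couple_direct_sum br \<sigma> G I D" and C': "couple_direct_sum br \<sigma> G K C'"
    and i: "i \<in> I" and ind: "indecomposable br \<sigma> (D i)" and nf: "\<not> flat \<sigma> (D i)"
    and C'k: "\<And>k. k \<in> K \<Longrightarrow> flat \<sigma> (C' k) \<or> indecomposable br \<sigma> (C' k)"
  obtains k where "k \<in> K" "\<not> flat \<sigma> (C' k)"
    "bij_betw (component K C' k) (D i) (C' k)" "bij_betw (component I D i) (C' k) (D i)"
proof -
  interpret M: symmetric_couple br \<sigma> "D i" by (rule direct_sum_couple[OF D i])
  let ?e = "component I D i" and ?e' = "component K C'"
  note DiG = stable_idealD(2)[OF direct_sum_ideal[OF D i]]
  have nz: "D i \<noteq> {0}" using nf flat_zero by metis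
  have e': "equivariant br \<sigma> G (D i) (C' k) (?e' k)" if "k \<in> K" for k
    by (rule equivariant_subset[OF component_equivariant[OF C' that] order_refl DiG])
  have e: "equivariant br \<sigma> G (C' k) (D i) ?e" if "k \<in> K" for k
    by (rule equivariant_subset[OF component_equivariant[OF D i] order_refl
          stable_idealD(2)[OF direct_sum_ideal[OF C' that]]])
  have "(\<Sum>k\<in>K. ?e (?e' k x)) = x" if x: "x \<in> D i" for x
  proof -
    have xG: "x \<in> G" using DiG x by blast
    have "(\<Sum>k\<in>K. ?e (?e' k x)) = ?e (\<Sum>k\<in>K. ?e' k x)"
      by (rule equivariant_sum[OF component_equivariant[OF D i] subspace component_in[OF C' xG], symmetric])
    also have "\<dots> = x" using sum_components[OF C' xG] component_of_summand[OF D i x i] by simp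
    finally show ?thesis .
  qed
  then have "inj_on (\<lambda>x. \<Sum>k\<in>K. ?e (?e' k x)) (D i)" by (simp add: inj_on_def)
  moreover have "equivariant br \<sigma> (D i) (D i) (D i) (\<lambda>x. ?e (?e' k x))" if "k \<in> K" for k
    by (rule equivariant_subset[OF equivariant_comp[OF e' e] DiG order_refl]) (rule that)+
  ultimately have "\<exists>k\<in>K. inj_on (\<lambda>x. ?e (?e' k x)) (D i)"
    by (intro M.inj_member_of_inj_sum[OF direct_sum_finite[OF C'] _ ind nz])
  then obtain k where k: "k \<in> K" and inj: "inj_on (\<lambda>x. ?e (?e' k x)) (D i)" by (rule bexE)
  have "inj_on (?e' k) (D i)" using inj inj_on_imageI2[of ?e "?e' k"] by (simp add: comp_def)
  then have nf': "\<not> flat \<sigma> (C' k)" using flat_if_inj_into_flat[OF e'[OF k] M.subspace] nf by blast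
  show ?thesis
    using that[OF k nf'] mutual_bij[OF M.symmetric_couple_axioms DiG ind nz
        direct_sum_couple[OF C' k] stable_idealD(2)[OF direct_sum_ideal[OF C' k]] _ e'[OF k] e[OF k] inj]
      C'k[OF k] nf' by blast
qed

text \<open>
  The hybrid decomposition in the conclusion is what makes the partners distinct. A summand \<open>C' k\<close>
  that is already in use belongs to the hybrid, so the hybrid projection onto \<open>C i\<close> kills it;
  but this projection maps the partner found for \<open>C i\<close> bijectively onto \<open>C i\<close>.
\<close>
lemma direct_sum_matching:
  assumes C: "couple_direct_sum br \<sigma> G I C" and C': "couple_direct_sum br \<sigma> G K C'"
    and J: "J \<subseteq> I" "\<And>i. i \<in> J \<Longrightarrow> indecomposable br \<sigma> (C i) \<and> \<not> flat \<sigma> (C i)"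
    and C'k: "\<And>k. k \<in> K \<Longrightarrow> flat \<sigma> (C' k) \<or> indecomposable br \<sigma> (C' k)"
  shows "\<exists>\<eta>. inj_on \<eta> J \<and> couple_direct_sum br \<sigma> G I (\<lambda>i. if i \<in> J then C' (\<eta> i) else C i) \<and>
    (\<forall>i\<in>J. \<eta> i \<in> K \<and> \<not> flat \<sigma> (C' (\<eta> i)) \<and> bij_betw (component K C' (\<eta> i)) (C i) (C' (\<eta> i)))"
proof -
  have "finite J" using J(1) direct_sum_finite[OF C] by (rule finite_subset)
  then show ?thesis using J
  proof (induction J rule: finite_induct)
    case empty
    then show ?case using C by simp
  next
    case (insert i J)
    then obtain \<eta> where inj: "inj_on \<eta> J"
      and D: "couple_direct_sum br \<sigma> G I (\<lambda>i. if i \<in> J then C' (\<eta> i) else C i)"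
      and \<eta>: "\<And>i. i \<in> J \<Longrightarrow> \<eta> i \<in> K \<and> \<not> flat \<sigma> (C' (\<eta> i)) \<and>
        bij_betw (component K C' (\<eta> i)) (C i) (C' (\<eta> i))"
      by auto
    define D' where "D' = (\<lambda>i. if i \<in> J then C' (\<eta> i) else C i)"
    have i: "i \<in> I" "D' i = C i" using insert by (simp_all add: D'_def)
    obtain k where k: "k \<in> K" "\<not> flat \<sigma> (C' k)" "bij_betw (component K C' k) (C i) (C' k)"
      and b: "bij_betw (component I D' i) (C' k) (C i)"
      using matching_summand[OF D[folded D'_def] C' i(1) _ _ C'k] insert.prems(2)[of i] i(2) by auto
    have new: "k \<notin> \<eta> ` J"
    proof
      assume "k \<in> \<eta> ` J"
      then obtain j where j: "k = \<eta> j" "j \<in> J" by (rule imageE)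
      then have jI: "j \<in> I" "D' j = C' k" "i \<noteq> j" using insert by (auto simp: D'_def)
      then have "component I D' i ` C' k \<subseteq> {0}"
        using component_of_summand[OF D[folded D'_def] jI(1) _ i(1)] by auto
      then have "C i \<subseteq> {0}" using b by (simp add: bij_betw_def)
      then have "C i = {0}" using direct_sum_zero[OF C i(1)] by blast
      then show False using insert.prems(2)[of i] flat_zero by simp
    qed
    have ex: "couple_direct_sum br \<sigma> G I (D'(i := C' k))"
      by (rule direct_sum_exchange[OF D[folded D'_def] i(1) direct_sum_ideal[OF C' k(1)]
            direct_sum_couple[OF C' k(1)] b[folded i(2)]])
    have eq: "D'(i := C' k) = (\<lambda>l. if l \<in> insert i J then C' ((\<eta>(i := k)) l) else C l)"
      using insert.hyps(2) by (auto simp: D'_def fun_eq_iff)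
    show ?case
    proof (intro exI conjI ballI)
      show "inj_on (\<eta>(i := k)) (insert i J)"
        using inj new insert.hyps(2) by (auto simp: inj_on_def)
      show "couple_direct_sum br \<sigma> G I (\<lambda>l. if l \<in> insert i J then C' ((\<eta>(i := k)) l) else C l)"
        using ex unfolding eq .
      fix l assume "l \<in> insert i J"
      then show "(\<eta>(i := k)) l \<in> K" "\<not> flat \<sigma> (C' ((\<eta>(i := k)) l))"
        "bij_betw (component K C' ((\<eta>(i := k)) l)) (C l) (C' ((\<eta>(i := k)) l))"
        using \<eta> k by auto
    qed
  qed
qed

section \<open>Automorphisms and the flat summands\<close>

text \<open>
  The automorphism is the direct sum of the given bijections. Its compatibility with the bracket is
  checked on the components in the \<open>C'\<close>-decomposition: these determine a vector, and on each of them
  the automorphism is a composite of two projections, which both preserve brackets.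
\<close>
lemma automorphism_of_matching:
  assumes C: "couple_direct_sum br \<sigma> G I C" and C': "couple_direct_sum br \<sigma> G K C'"
    and \<eta>: "bij_betw \<eta> I K"
    and bij: "\<And>i. i \<in> I \<Longrightarrow> bij_betw (component K C' (\<eta> i)) (C i) (C' (\<eta> i))"
  shows "\<exists>\<phi>. couple_automorphism br \<sigma> G \<phi> \<and> (\<forall>i\<in>I. \<phi> ` C i = C' (\<eta> i))"
proof -
  let ?e = "component I C" and ?e' = "component K C'"
  define \<phi> where "\<phi> x = (\<Sum>i\<in>I. ?e' (\<eta> i) (?e i x))" for x
  have \<eta>K: "\<eta> i \<in> K" if "i \<in> I" for i using bij_betwE[OF \<eta>] that by blast
  have mem: "?e' (\<eta> i) (?e i x) \<in> C' (\<eta> i)" if "x \<in> G" "i \<in> I" for x i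
    using component_mem[OF C' component_in[OF C that] \<eta>K[OF that(2)]] .
  have memG: "?e' (\<eta> i) (?e i x) \<in> G" if "x \<in> G" "i \<in> I" for x i
    using direct_sum_mem[OF C' \<eta>K[OF that(2)] mem[OF that]] .
  have comp: "equivariant br \<sigma> G G G (\<lambda>x. ?e' (\<eta> i) (?e i x))" if i: "i \<in> I" for i
  proof -
    have sub: "C i \<subseteq> G" "C' (\<eta> i) \<subseteq> G"
      using direct_sum_ideal[OF C i] direct_sum_ideal[OF C' \<eta>K[OF i]] stable_idealD(2) by metis+
    have "equivariant br \<sigma> G G (C' (\<eta> i)) (\<lambda>x. ?e' (\<eta> i) (?e i x))"
      by (rule equivariant_comp[OF component_equivariant[OF C i]
            equivariant_subset[OF component_equivariant[OF C' \<eta>K[OF i]] order_refl sub(1)]])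
    then show ?thesis using sub(2) unfolding equivariant_def by blast
  qed
  have \<phi>G: "\<phi> x \<in> G" if "x \<in> G" for x
    unfolding \<phi>_def by (rule subspace_sum[OF subspace]) (rule memG[OF that])
  have e'\<phi>: "?e' (\<eta> i) (\<phi> x) = ?e' (\<eta> i) (?e i x)" if x: "x \<in> G" and i: "i \<in> I" for x i
  proof -
    let ?t = "the_inv_into I \<eta>"
    have t: "?t (\<eta> i) = i" if "i \<in> I" for i
      using the_inv_into_f_f[OF bij_betw_imp_inj_on[OF \<eta>] that] .
    have t': "\<eta> (?t k) = k" "?t k \<in> I" if "k \<in> K" for k
      using f_the_inv_into_f_bij_betw[OF \<eta>] bij_betwE[OF bij_betw_the_inv_into[OF \<eta>]] that by blast+
    have "?e' (\<eta> i) (\<phi> x) = (\<lambda>k. ?e' k (?e (?t k) x)) (\<eta> i)"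
    proof (rule component_eqI[OF C'])
      show "?e' k (?e (?t k) x) \<in> C' k" if "k \<in> K" for k
        using mem[OF x t'(2)[OF that]] t'(1)[OF that] by simp
      have "(\<Sum>k\<in>K. ?e' k (?e (?t k) x)) = (\<Sum>i\<in>I. ?e' (\<eta> i) (?e (?t (\<eta> i)) x))"
        by (rule sum.reindex_bij_betw[OF \<eta>, symmetric])
      also have "\<dots> = \<phi> x" unfolding \<phi>_def by (rule sum.cong[OF refl]) (simp add: t)
      finally show "(\<Sum>k\<in>K. ?e' k (?e (?t k) x)) = \<phi> x" .
    qed (rule \<eta>K[OF i])
    then show ?thesis using t[OF i] by simp
  qed
  have eqI: "x = y" if "x \<in> G" "y \<in> G" "\<And>i. i \<in> I \<Longrightarrow> ?e' (\<eta> i) x = ?e' (\<eta> i) y" for x y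
  proof (rule eq_if_components_eq[OF C' that(1,2)])
    fix k assume "k \<in> K"
    then have "k \<in> \<eta> ` I" using \<eta> by (simp add: bij_betw_def)
    then show "?e' k x = ?e' k y" using that(3) by (elim imageE) simp
  qed
  have "bij_betw \<phi> G G"
  proof (rule bij_betw_imageI)
    show "inj_on \<phi> G"
    proof (rule inj_onI)
      fix x y assume xy: "x \<in> G" "y \<in> G" "\<phi> x = \<phi> y"
      have "?e i x = ?e i y" if i: "i \<in> I" for i
        using inj_onD[OF bij_betw_imp_inj_on[OF bij[OF i]] _ component_mem[OF C xy(1) i]
            component_mem[OF C xy(2) i]] e'\<phi>[OF xy(1) i] e'\<phi>[OF xy(2) i] xy(3) by simp
      then show "x = y" by (rule eq_if_components_eq[OF C xy(1,2)])
    qed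
    show "\<phi> ` G = G"
    proof
      show "\<phi> ` G \<subseteq> G" using \<phi>G by (rule image_subsetI)
      show "G \<subseteq> \<phi> ` G"
      proof
        fix z assume z: "z \<in> G"
        define w where "w i = the_inv_into (C i) (?e' (\<eta> i)) (?e' (\<eta> i) z)" for i
        have ez: "?e' (\<eta> i) z \<in> C' (\<eta> i)" if "i \<in> I" for i
          using component_mem[OF C' z \<eta>K[OF that]] .
        have w: "w i \<in> C i" "?e' (\<eta> i) (w i) = ?e' (\<eta> i) z" if i: "i \<in> I" for i
          unfolding w_def using bij_betwE[OF bij_betw_the_inv_into[OF bij[OF i]]] ez[OF i]
            f_the_inv_into_f_bij_betw[OF bij[OF i]] by blast+
        have sG: "(\<Sum>i\<in>I. w i) \<in> G"
          by (rule subspace_sum[OF subspace]) (rule direct_sum_mem[OF C _ w(1)])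
        have "\<phi> (\<Sum>i\<in>I. w i) = z"
        proof (rule eqI[OF \<phi>G[OF sG] z])
          fix i assume i: "i \<in> I"
          have "?e i (\<Sum>i\<in>I. w i) = w i" by (rule component_sum[OF C w(1) i])
          then show "?e' (\<eta> i) (\<phi> (\<Sum>i\<in>I. w i)) = ?e' (\<eta> i) z"
            using e'\<phi>[OF sG i] w(2)[OF i] by simp
        qed
        then show "z \<in> \<phi> ` G" using sG by (metis imageI)
      qed
    qed
  qed
  moreover have "\<phi> (x + y) = \<phi> x + \<phi> y" if "x \<in> G" "y \<in> G" for x y
    unfolding \<phi>_def sum.distrib[symmetric]
    by (rule sum.cong[OF refl]) (rule equivariantD(2)[OF comp that])
  moreover have "\<phi> (r *\<^sub>R x) = r *\<^sub>R \<phi> x" if "x \<in> G" for r x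
    unfolding \<phi>_def scaleR_sum_right
    by (rule sum.cong[OF refl]) (rule equivariantD(3)[OF comp that])
  moreover have "\<phi> (br x y) = br (\<phi> x) (\<phi> y)" if xy: "x \<in> G" "y \<in> G" for x y
  proof (rule eqI)
    show "\<phi> (br x y) \<in> G" "br (\<phi> x) (\<phi> y) \<in> G" using \<phi>G closed xy by simp_all
    fix i assume i: "i \<in> I"
    show "?e' (\<eta> i) (\<phi> (br x y)) = ?e' (\<eta> i) (br (\<phi> x) (\<phi> y))"
      using xy i by (simp add: e'\<phi> closed component_br[OF C] component_br[OF C'] component_in[OF C] \<eta>K \<phi>G)
  qed
  moreover have "\<phi> (\<sigma> x) = \<sigma> (\<phi> x)" if x: "x \<in> G" for x
  proof -
    have "\<sigma> (\<phi> x) = (\<Sum>i\<in>I. \<sigma> (?e' (\<eta> i) (?e i x)))"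
      unfolding \<phi>_def by (rule sigma_sum) (rule memG[OF x])
    also have "\<dots> = \<phi> (\<sigma> x)" unfolding \<phi>_def
      by (rule sum.cong[OF refl]) (rule equivariantD(5)[OF comp x, symmetric])
    finally show ?thesis by simp
  qed
  moreover have "\<phi> ` C i = C' (\<eta> i)" if i: "i \<in> I" for i
  proof -
    have "\<phi> x = ?e' (\<eta> i) x" if x: "x \<in> C i" for x
    proof -
      have "\<phi> x = (\<Sum>j\<in>I. if j = i then ?e' (\<eta> i) x else 0)" unfolding \<phi>_def
        by (rule sum.cong[OF refl])
          (simp add: component_of_summand[OF C i x] equivariant_zero[OF component_equivariant[OF C' \<eta>K] subspace])
      then show ?thesis using direct_sum_finite[OF C] i by simp
    qed
    then have "\<phi> ` C i = ?e' (\<eta> i) ` C i" by (rule image_cong[OF refl])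
    then show ?thesis using bij[OF i] by (simp add: bij_betw_def)
  qed
  ultimately show ?thesis unfolding couple_automorphism_def lie_automorphism_def by blast
qed

text \<open>
  Both decompositions of \<open>G\<close> have the same sum of summands other than the chosen one, and projecting
  along a common complement identifies any two of its complements.
\<close>
lemma component_bij_of_common_complement:
  assumes H: "couple_direct_sum br \<sigma> G I H" and C': "couple_direct_sum br \<sigma> G K C'"
    and \<eta>: "bij_betw \<eta> I K" and i\<^sub>0: "i\<^sub>0 \<in> I"
    and eq: "\<And>i. i \<in> I \<Longrightarrow> i \<noteq> i\<^sub>0 \<Longrightarrow> H i = C' (\<eta> i)"
  shows "bij_betw (component K C' (\<eta> i\<^sub>0)) (H i\<^sub>0) (C' (\<eta> i\<^sub>0))"
proof (rule bij_betw_imageI)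
  let ?e = "component I H" and ?e' = "component K C'"
  have \<eta>K: "\<eta> i \<in> K" if "i \<in> I" for i using bij_betwE[OF \<eta>] that by blast
  have HG: "H i\<^sub>0 \<subseteq> G" using stable_idealD(2)[OF direct_sum_ideal[OF H i\<^sub>0]] .
  note e'i\<^sub>0 = component_equivariant[OF C' \<eta>K[OF i\<^sub>0]]
  show "inj_on (?e' (\<eta> i\<^sub>0)) (H i\<^sub>0)"
  proof (rule equivariant_inj_onI[OF equivariant_subset[OF e'i\<^sub>0 order_refl HG]])
    show "subspace (H i\<^sub>0)" by (rule stable_idealD(1)[OF direct_sum_ideal[OF H i\<^sub>0]])
    fix x assume x: "x \<in> H i\<^sub>0" "?e' (\<eta> i\<^sub>0) x = 0"
    then have xG: "x \<in> G" using HG by blast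
    have "?e i\<^sub>0 x = ?e' (\<eta> i\<^sub>0) x"
    proof (rule component_eqI[OF H _ _ i\<^sub>0])
      show "?e' (\<eta> i) x \<in> H i" if "i \<in> I" for i
        using component_mem[OF C' xG \<eta>K[OF that]] eq[OF that] x(2) direct_sum_zero[OF H i\<^sub>0]
        by (cases "i = i\<^sub>0") simp_all
      show "(\<Sum>i\<in>I. ?e' (\<eta> i) x) = x"
        using sum.reindex_bij_betw[OF \<eta>, of "\<lambda>k. ?e' k x"] sum_components[OF C' xG] by simp
    qed
    then show "x = 0" using x component_of_summand[OF H i\<^sub>0 x(1) i\<^sub>0] by simp
  qed
  show "?e' (\<eta> i\<^sub>0) ` H i\<^sub>0 = C' (\<eta> i\<^sub>0)"
  proof
    show "?e' (\<eta> i\<^sub>0) ` H i\<^sub>0 \<subseteq> C' (\<eta> i\<^sub>0)" using equivariantD(1)[OF e'i\<^sub>0] HG by blast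
    show "C' (\<eta> i\<^sub>0) \<subseteq> ?e' (\<eta> i\<^sub>0) ` H i\<^sub>0"
    proof
      fix z assume z: "z \<in> C' (\<eta> i\<^sub>0)"
      have zG: "z \<in> G" using direct_sum_mem[OF C' \<eta>K[OF i\<^sub>0] z] .
      have zero: "?e' (\<eta> i\<^sub>0) (?e i z) = 0" if i: "i \<in> I" "i \<noteq> i\<^sub>0" for i
      proof -
        have "\<eta> i\<^sub>0 \<noteq> \<eta> i" using inj_onD[OF bij_betw_imp_inj_on[OF \<eta>] _ i\<^sub>0 i(1)] i(2) by blast
        moreover have "?e i z \<in> C' (\<eta> i)" using component_mem[OF H zG i(1)] eq[OF i] by simp
        ultimately show ?thesis using component_of_summand[OF C' \<eta>K[OF i(1)] _ \<eta>K[OF i\<^sub>0]] by simp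
      qed
      have "z = ?e' (\<eta> i\<^sub>0) (\<Sum>i\<in>I. ?e i z)"
        using sum_components[OF H zG] component_of_summand[OF C' \<eta>K[OF i\<^sub>0] z \<eta>K[OF i\<^sub>0]] by simp
      also have "\<dots> = (\<Sum>i\<in>I. ?e' (\<eta> i\<^sub>0) (?e i z))"
        by (rule equivariant_sum[OF e'i\<^sub>0 subspace component_in[OF H zG]])
      also have "\<dots> = (\<Sum>i\<in>I. if i = i\<^sub>0 then ?e' (\<eta> i\<^sub>0) (?e i\<^sub>0 z) else 0)"
        by (rule sum.cong[OF refl]) (simp add: zero)
      also have "\<dots> = ?e' (\<eta> i\<^sub>0) (?e i\<^sub>0 z)" using direct_sum_finite[OF H] i\<^sub>0 by simp
      finally show "z \<in> ?e' (\<eta> i\<^sub>0) ` H i\<^sub>0" using component_mem[OF H zG i\<^sub>0] by (rule image_eqI)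
    qed
  qed
qed

text \<open>
  Non-flat summands have non-flat partners, so the flat summand with index 0 is never a partner.
\<close>
lemma nonflat_summands_le:
  fixes C C' :: "nat \<Rightarrow> 'a set"
  assumes C: "couple_direct_sum br \<sigma> G {0..p} C" and C': "couple_direct_sum br \<sigma> G {0..q} C'"
    and flat: "flat \<sigma> (C' 0)"
    and Ci: "\<And>i. i \<in> {1..p} \<Longrightarrow> indecomposable br \<sigma> (C i) \<and> \<not> flat \<sigma> (C i)"
    and C'k: "\<And>k. k \<in> {1..q} \<Longrightarrow> indecomposable br \<sigma> (C' k) \<and> \<not> flat \<sigma> (C' k)"
  obtains \<eta> where "inj_on \<eta> {1..p}" "\<eta> ` {1..p} \<subseteq> {1..q}" "p \<le> q"
    "couple_direct_sum br \<sigma> G {0..p} (\<lambda>i. if i \<in> {1..p} then C' (\<eta> i) else C i)"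
    "\<And>i. i \<in> {1..p} \<Longrightarrow> bij_betw (component {0..q} C' (\<eta> i)) (C i) (C' (\<eta> i))"
proof -
  have alt: "flat \<sigma> (C' k) \<or> indecomposable br \<sigma> (C' k)" if "k \<in> {0..q}" for k
    using that flat C'k[of k] by (cases "k = 0") auto
  obtain \<eta> where inj: "inj_on \<eta> {1..p}"
    and H: "couple_direct_sum br \<sigma> G {0..p} (\<lambda>i. if i \<in> {1..p} then C' (\<eta> i) else C i)"
    and \<eta>: "\<And>i. i \<in> {1..p} \<Longrightarrow> \<eta> i \<in> {0..q} \<and> \<not> flat \<sigma> (C' (\<eta> i)) \<and>
      bij_betw (component {0..q} C' (\<eta> i)) (C i) (C' (\<eta> i))"
    using direct_sum_matching[OF C C' _ Ci alt, of "{1..p}"] by auto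
  have "\<eta> i \<in> {1..q}" if "i \<in> {1..p}" for i
    using \<eta>[OF that] flat by (cases "\<eta> i = 0") auto
  then have im: "\<eta> ` {1..p} \<subseteq> {1..q}" by (rule image_subsetI)
  then have "p \<le> q" using card_inj_on_le[OF inj im] by simp
  then show ?thesis using that[OF inj im _ H] \<eta> by blast
qed

end

theorem theorem2p1p3:
  fixes br :: "'a::real_vector \<Rightarrow> 'a \<Rightarrow> 'a" and \<sigma> :: "'a \<Rightarrow> 'a" and G :: "'a set"
    and C C' :: "nat \<Rightarrow> 'a set" and p q :: nat
  assumes "symmetric_couple br \<sigma> G"
    and "couple_direct_sum br \<sigma> G {0..p} C"
    and "couple_direct_sum br \<sigma> G {0..q} C'"
    and "flat \<sigma> (C 0)"
    and "flat \<sigma> (C' 0)"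
    and "\<And>\<alpha>. \<alpha> \<in> {1..p} \<Longrightarrow> indecomposable br \<sigma> (C \<alpha>) \<and> \<not> flat \<sigma> (C \<alpha>)"
    and "\<And>\<beta>. \<beta> \<in> {1..q} \<Longrightarrow> indecomposable br \<sigma> (C' \<beta>) \<and> \<not> flat \<sigma> (C' \<beta>)"
  shows "p = q \<and>
    (\<exists>\<phi> \<eta>. couple_automorphism br \<sigma> G \<phi> \<and> \<eta> permutes {1..p} \<and>
      \<phi> ` C 0 = C' 0 \<and> (\<forall>\<alpha>\<in>{1..p}. \<phi> ` C \<alpha> = C' (\<eta> \<alpha>)))"
proof -
  interpret symmetric_couple br \<sigma> G by (rule assms(1))
  obtain \<eta> where inj: "inj_on \<eta> {1..p}" and im: "\<eta> ` {1..p} \<subseteq> {1..q}" and le: "p \<le> q"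
    and H: "couple_direct_sum br \<sigma> G {0..p} (\<lambda>i. if i \<in> {1..p} then C' (\<eta> i) else C i)"
    and bij: "\<And>i. i \<in> {1..p} \<Longrightarrow> bij_betw (component {0..q} C' (\<eta> i)) (C i) (C' (\<eta> i))"
    by (rule nonflat_summands_le[OF assms(2,3,5,6,7)]) blast+
  have "q \<le> p"
    by (rule nonflat_summands_le[OF assms(3,2,4,7,6)]) blast+
  with le have pq: "p = q" by simp
  \<comment> \<open>A permutation of \<open>{1..p}\<close> must be the identity elsewhere; in particular it matches 0 with 0.\<close>
  define \<theta> where "\<theta> i = (if i \<in> {1..p} then \<eta> i else i)" for i
  have "bij_betw \<eta> {1..p} {1..p}"
    using inj endo_inj_surj[OF _ _ inj] im pq by (simp add: bij_betw_def)
  then have "bij_betw \<theta> {1..p} {1..p}"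
    using bij_betw_cong[of "{1..p}" \<eta> \<theta>] by (simp add: \<theta>_def)
  then have perm: "\<theta> permutes {1..p}"
    by (rule bij_imp_permutes) (unfold \<theta>_def, rule if_not_P)
  have "\<theta> permutes {0..p}" by (rule permutes_subset[OF perm]) auto
  then have b\<theta>: "bij_betw \<theta> {0..p} {0..q}" using permutes_imp_bij pq by metis
  have \<theta>0: "\<theta> 0 = 0" by (simp add: \<theta>_def)
  have "bij_betw (component {0..q} C' (\<theta> 0)) (C 0) (C' (\<theta> 0))"
    using component_bij_of_common_complement[OF H assms(3) b\<theta>, of 0] by (simp add: \<theta>_def)
  then have "bij_betw (component {0..q} C' (\<theta> i)) (C i) (C' (\<theta> i))" if "i \<in> {0..p}" for i
    using that bij[of i] by (cases "i = 0") (simp_all add: \<theta>_def)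
  then obtain \<phi> where "couple_automorphism br \<sigma> G \<phi>" "\<And>i. i \<in> {0..p} \<Longrightarrow> \<phi> ` C i = C' (\<theta> i)"
    using automorphism_of_matching[OF assms(2,3) b\<theta>] by blast
  then have "couple_automorphism br \<sigma> G \<phi> \<and> \<theta> permutes {1..p} \<and> \<phi> ` C 0 = C' 0 \<and>
      (\<forall>\<alpha>\<in>{1..p}. \<phi> ` C \<alpha> = C' (\<theta> \<alpha>))"
    using perm \<theta>0 by simp
  with pq show ?thesis by blast
qed

end
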